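(* Let $t=0$. An element $(a,b)\in\mathbb{H}_0^{\times}$ is invertible in $\mathbb{H}_0$, with inverse $$\left(\frac{\overline{a}}{|a|^{2}},\;\frac{-b}{|a|^{2}}\right)\in\mathbb{H}_0^{\times},$$ if and only if $a\neq 0$ in $\mathbb{C}$. Equivalently, the elements of $\mathbb{H}_0^{\times}$ that are invertible are exactly those of the subset $\{(a,b)\in\mathbb{H}_0^{\times}: a\neq 0\}$; equivalently, the elements of $\mathbb{H}_0^{\times}$ that are not invertible are exactly those of the form $(0,b)\in\mathbb{H}_0^{\times}$.
   Context: For $t\in\mathbb{R}$, the $t$-scaled hypercomplex ring is $\mathbb{H}_t=(\mathbb{C}^2,+,\cdot_t)$, where $+$ is the usual vector addition and $(a_1,b_1)\cdot_t(a_2,b_2)=(a_1a_2+tb_1\overline{b_2},\;a_1b_2+b_1\overline{a_2})$, with unity $(1,0)$. Put $\mathbb{H}_t^{\times}=\mathbb{H}_t\setminus\{(0,0)\}$. An element $\xi\in\mathbb{H}_t$ is invertible if there is $\eta\in\mathbb{H}_t$ with $\xi\cdot_t\eta=(1,0)=\eta\cdot_t\xi$. *)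

theory Defs
  imports Complex_Main "HOL-Library.Product_Plus" "HOL-Algebra.Ring"
begin

definition hmult :: "real \<Rightarrow> complex \<times> complex \<Rightarrow> complex \<times> complex \<Rightarrow> complex \<times> complex" where
  "hmult t = (\<lambda>(a1, b1) (a2, b2).
     (a1 * a2 + complex_of_real t * b1 * cnj b2, a1 * b2 + b1 * cnj a2))"

definition hypercomplex :: "real \<Rightarrow> (complex \<times> complex) ring" where
  "hypercomplex t =
     \<lparr>carrier = UNIV, mult = hmult t, one = (1, 0), zero = (0, 0), add = (+)\<rparr>"

text \<open>
  This is the set of nonzero elements, which is in general larger than the set
  \<^term>\<open>Units (hypercomplex t)\<close> of invertible elements.
\<close>

definition hypercomplex_nonzero :: "real \<Rightarrow> (complex \<times> complex) set" where
  "hypercomplex_nonzero t = carrier (hypercomplex t) - {\<zero>\<^bsub>hypercomplex t\<^esub>}"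

lemma ring_hypercomplex: "ring (hypercomplex t)"
proof (rule ringI)
  show "abelian_group (hypercomplex t)"
  proof (rule abelian_groupI)
    fix x assume "x \<in> carrier (hypercomplex t)"
    show "\<exists>y\<in>carrier (hypercomplex t). y \<oplus>\<^bsub>hypercomplex t\<^esub> x = \<zero>\<^bsub>hypercomplex t\<^esub>"
      by (rule bexI[of _ "- x"]) (simp_all add: hypercomplex_def zero_prod_def)
  qed (auto simp: hypercomplex_def zero_prod_def[symmetric] add.assoc add.commute)
  show "monoid (hypercomplex t)"
    by (rule monoidI) (auto simp: hypercomplex_def hmult_def algebra_simps)
qed (auto simp: hypercomplex_def hmult_def algebra_simps)

end

theory Submission
  imports Defs
begin

text \<open>
  For \<open>t = 0\<close> the term \<open>t b\<^sub>1 cnj b\<^sub>2\<close> vanishes from the first component of a product, so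
  \<open>(a, b) \<mapsto> a\<close> is multiplicative. It therefore sends units to units of the field
  \<open>\<complex>\<close>, which forces \<open>a \<noteq> 0\<close>; this is \<open>fst_nonzero_if_Unit_hypercomplex_0\<close>.
  Conversely, the conjugate \<open>(cnj a, -b)\<close> multiplies with \<open>(a, b)\<close>, on either side, to
  \<open>(|a|\<^sup>2, 0)\<close>. A real scalar is central, so dividing the conjugate by
  \<open>|a|\<^sup>2 \<noteq> 0\<close> gives a two-sided inverse, which is
  \<open>hmult_0_conjugate_right\<close> and \<open>hmult_0_conjugate_left\<close>.
\<close>

lemma fst_hmult_0: "fst (hmult 0 x y) = fst x * fst y"
  by (simp add: hmult_def split: prod.split)

lemma fst_nonzero_if_Unit_hypercomplex_0:
  assumes "x \<in> Units (hypercomplex 0)"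
  shows "fst x \<noteq> 0"
proof -
  obtain y where "hmult 0 x y = (1, 0)"
    using assms by (auto simp: Units_def hypercomplex_def)
  then have "fst x * fst y = 1"
    by (metis fst_hmult_0 fst_conv)
  then show ?thesis
    by auto
qed

text \<open>
  The second component is \<open>(- a b + b a) / |a|\<^sup>2\<close>: the conjugation in the twisted product
  undoes the one in \<open>cnj a\<close>, and the two terms cancel.
\<close>

lemma hmult_0_conjugate_right:
  assumes "a \<noteq> 0"
  shows "hmult 0 (a, b)
           (cnj a / complex_of_real ((cmod a)\<^sup>2), - b / complex_of_real ((cmod a)\<^sup>2)) = (1, 0)"
  using assms by (simp add: hmult_def complex_norm_square[symmetric])

text \<open>
  Here both terms of the second component carry the factor \<open>cnj a\<close>, so they cancel already
  because the entry of the conjugate is \<open>-b\<close>.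
\<close>

lemma hmult_0_conjugate_left:
  assumes "a \<noteq> 0"
  shows "hmult 0 (cnj a / complex_of_real ((cmod a)\<^sup>2), - b / complex_of_real ((cmod a)\<^sup>2))
           (a, b) = (1, 0)"
  using assms by (simp add: hmult_def complex_norm_square[symmetric] mult.commute)

lemma Units_hypercomplex_0_iff: "(a, b) \<in> Units (hypercomplex 0) \<longleftrightarrow> a \<noteq> 0"
proof
  assume "(a, b) \<in> Units (hypercomplex 0)"
  then show "a \<noteq> 0"
    using fst_nonzero_if_Unit_hypercomplex_0 by fastforce
next
  assume "a \<noteq> 0"
  then show "(a, b) \<in> Units (hypercomplex 0)"
    using hmult_0_conjugate_right[of a b] hmult_0_conjugate_left[of a b]
    unfolding Units_def hypercomplex_def by auto
qed

lemma inv_hypercomplex_0: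
  assumes "a \<noteq> 0"
  shows "inv\<^bsub>hypercomplex 0\<^esub> (a, b)
           = (cnj a / complex_of_real ((cmod a)\<^sup>2), - b / complex_of_real ((cmod a)\<^sup>2))"
proof -
  interpret ring "hypercomplex 0"
    by (rule ring_hypercomplex)
  show ?thesis
    using hmult_0_conjugate_right[OF assms, of b] hmult_0_conjugate_left[OF assms, of b]
    by (intro inv_unique'[symmetric]) (simp_all add: hypercomplex_def)
qed

lemma hypercomplex_nonzero_iff: "(a, b) \<in> hypercomplex_nonzero t \<longleftrightarrow> a \<noteq> 0 \<or> b \<noteq> 0"
  by (auto simp: hypercomplex_nonzero_def hypercomplex_def)

theorem theorem12:
  shows "(\<forall>a b. (a, b) \<in> hypercomplex_nonzero 0 \<longrightarrow>
            ((a, b) \<in> Units (hypercomplex 0) \<longleftrightarrow> a \<noteq> 0) \<and>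
            (a \<noteq> 0 \<longrightarrow>
               inv\<^bsub>hypercomplex 0\<^esub> (a, b)
                 = (cnj a / complex_of_real ((cmod a)\<^sup>2), - b / complex_of_real ((cmod a)\<^sup>2)) \<and>
               (cnj a / complex_of_real ((cmod a)\<^sup>2), - b / complex_of_real ((cmod a)\<^sup>2))
                 \<in> hypercomplex_nonzero 0))
       \<and> {\<xi> \<in> hypercomplex_nonzero 0. \<xi> \<in> Units (hypercomplex 0)}
           = {(a, b) | a b. (a, b) \<in> hypercomplex_nonzero 0 \<and> a \<noteq> 0}
       \<and> {\<xi> \<in> hypercomplex_nonzero 0. \<xi> \<notin> Units (hypercomplex 0)}
           = {(0, b) | b. (0, b) \<in> hypercomplex_nonzero 0}"
  by (auto simp: Units_hypercomplex_0_iff inv_hypercomplex_0 hypercomplex_nonzero_iff)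

end
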